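(* Let $m\geq 3$ and let $G=S(3,1^{m-1})$ be the starlike tree of order $m+3$ (the tree on vertices $o,x_1,\dots,x_m,y,z$ with edges $ox_1,\dots,ox_m,x_1y,yz$). Then $b(G)=\frac{m^2+m-4}{2}$.
   Context: All graphs are finite and simple. For vertices $u,v$ of a graph $G$, $d_G(u,v)$ is the length of a shortest $u$–$v$ path. For an edge $xy$ of $G$, $W^G_{xy}=\{u\in V(G): d_G(u,x)<d_G(u,y)\}$. A graph is distance-balanced if $|W^G_{xy}|=|W^G_{yx}|$ for every edge $xy$. For a graph $H$, $b(H)$ is the smallest number of edges which can be added to $H$ (keeping the vertex set) so that the resulting graph is distance-balanced. A starlike tree is a tree with exactly one vertex of degree greater than two; $S(n_1^{\alpha_1},\dots,n_k^{\alpha_k})$ denotes the starlike tree in which deleting the central vertex leaves $\alpha_i$ paths with $n_i$ vertices for each $i$. *)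

theory Defs
  imports Complex_Main "HOL-Library.Extended_Nat"
begin

text \<open>A graph is given by its vertex set \<open>V\<close> and its edge set \<open>E\<close>, whose members are
  two-element subsets of \<open>V\<close>.\<close>

definition simple_graph :: "'a set \<Rightarrow> 'a set set \<Rightarrow> bool" where
  "simple_graph V E \<longleftrightarrow> finite V \<and> (\<forall>e\<in>E. e \<subseteq> V \<and> card e = 2)"

definition degree :: "'a set set \<Rightarrow> 'a \<Rightarrow> nat" where
  "degree E v = card {e \<in> E. v \<in> e}"

definition path_edges :: "'a list \<Rightarrow> 'a set set" where
  "path_edges p = {{p ! i, p ! Suc i} | i. Suc i < length p}"

definition gpath :: "'a set \<Rightarrow> 'a set set \<Rightarrow> 'a list \<Rightarrow> bool" where
  "gpath V E p \<longleftrightarrow> p \<noteq> [] \<and> distinct p \<and> set p \<subseteq> V \<and> path_edges p \<subseteq> E"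

definition paths_between :: "'a set \<Rightarrow> 'a set set \<Rightarrow> 'a \<Rightarrow> 'a \<Rightarrow> 'a list set" where
  "paths_between V E u v = {p. gpath V E p \<and> hd p = u \<and> last p = v}"

text \<open>The length of a path is its number of edges. The distance is \<open>\<infinity>\<close> if there is no path.\<close>

definition gdist :: "'a set \<Rightarrow> 'a set set \<Rightarrow> 'a \<Rightarrow> 'a \<Rightarrow> enat" where
  "gdist V E u v = (INF p \<in> paths_between V E u v. enat (length p - 1))"

definition closer :: "'a set \<Rightarrow> 'a set set \<Rightarrow> 'a \<Rightarrow> 'a \<Rightarrow> 'a set" where
  "closer V E x y = {u \<in> V. gdist V E u x < gdist V E u y}"

definition distance_balanced :: "'a set \<Rightarrow> 'a set set \<Rightarrow> bool" where
  "distance_balanced V E \<longleftrightarrow>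
     (\<forall>x y. {x, y} \<in> E \<longrightarrow> card (closer V E x y) = card (closer V E y x))"

text \<open>The minimum below is attained for every simple graph, because complete graphs are
  distance-balanced.\<close>

definition balancing_number :: "'a set \<Rightarrow> 'a set set \<Rightarrow> nat" where
  "balancing_number V E =
     (LEAST k. \<exists>F. F \<inter> E = {} \<and> card F = k \<and>
        simple_graph V (E \<union> F) \<and> distance_balanced V (E \<union> F))"

definition connected_graph :: "'a set \<Rightarrow> 'a set set \<Rightarrow> bool" where
  "connected_graph V E \<longleftrightarrow> V \<noteq> {} \<and> (\<forall>u\<in>V. \<forall>v\<in>V. paths_between V E u v \<noteq> {})"

definition acyclic_graph :: "'a set \<Rightarrow> 'a set set \<Rightarrow> bool" where
  "acyclic_graph V E \<longleftrightarrow>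
     \<not> (\<exists>p. gpath V E p \<and> length p \<ge> 3 \<and> {last p, hd p} \<in> E)"

definition tree :: "'a set \<Rightarrow> 'a set set \<Rightarrow> bool" where
  "tree V E \<longleftrightarrow> simple_graph V E \<and> connected_graph V E \<and> acyclic_graph V E"

definition starlike_tree :: "'a set \<Rightarrow> 'a set set \<Rightarrow> bool" where
  "starlike_tree V E \<longleftrightarrow> tree V E \<and> (\<exists>!c. c \<in> V \<and> degree E c > 2)"

text \<open>The graph with vertex set \<open>V\<close> and edge set \<open>E\<close> is the vertex-disjoint union of the
  nonempty paths listed in \<open>ps\<close>, with no edges other than those of the paths.\<close>

definition disjoint_union_of_paths :: "'a set \<Rightarrow> 'a set set \<Rightarrow> 'a list list \<Rightarrow> bool" where
  "disjoint_union_of_paths V E ps \<longleftrightarrow>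
     [] \<notin> set ps \<and> distinct (concat ps) \<and> set (concat ps) = V \<and>
     E = (\<Union>p\<in>set ps. path_edges p)"

text \<open>\<open>is_S V E ns\<close> says that the graph is (a copy of) the starlike tree whose branches have the
  orders listed in \<open>ns\<close>, with repetitions: \<open>S(3,1\<^sup>k)\<close> corresponds to
  \<open>ns = 3 # replicate k 1\<close>. The order of \<open>ns\<close> is irrelevant since the paths may be listed
  in any order.\<close>

definition is_S :: "'a set \<Rightarrow> 'a set set \<Rightarrow> nat list \<Rightarrow> bool" where
  "is_S V E ns \<longleftrightarrow> starlike_tree V E \<and>
     (\<exists>c\<in>V. degree E c > 2 \<and>
        (\<exists>ps. disjoint_union_of_paths (V - {c}) {e \<in> E. c \<notin> e} ps \<and> map length ps = ns))"

end

theory Submission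
  imports Defs
begin

text \<open>Write \<open>c\<close> for the centre. Adding the right edges gives the complement of a Hamiltonian cycle
  of the complement of \<open>G\<close>, which is \<open>m\<close>-regular of diameter 2 and hence distance-balanced.
  Conversely, if every vertex of a distance-balanced graph is within distance 2 of \<open>x\<close>, then no
  neighbour of \<open>x\<close> has smaller degree than \<open>x\<close>. In a distance-balanced supergraph of \<open>G\<close> this
  applies to \<open>c\<close>, because the far end of the long branch cannot be a leaf, and then to a common
  neighbour of \<open>c\<close> and any vertex not adjacent to \<open>c\<close>. So all degrees are at least \<open>m\<close>.\<close>

section \<open>Closed neighbourhoods and degrees\<close>

text \<open>The ball of radius 1. In a simple graph two vertices are at distance at most 2 exactly
  when their balls meet, so bounds on eccentricity can be stated as nonempty intersections.\<close>

definition closed_nbhd :: "'a set set \<Rightarrow> 'a \<Rightarrow> 'a set" where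
  "closed_nbhd E v = insert v {w. {v, w} \<in> E}"

lemma closed_nbhd_self [simp]: "v \<in> closed_nbhd E v"
  by (simp add: closed_nbhd_def)

lemma closed_nbhd_sym: "u \<in> closed_nbhd E v \<longleftrightarrow> v \<in> closed_nbhd E u"
  by (auto simp: closed_nbhd_def insert_commute)

lemma simple_graph_edgeD:
  assumes "simple_graph V E" "{u, v} \<in> E"
  shows "u \<in> V" "v \<in> V" "u \<noteq> v"
  using assms by (auto simp: simple_graph_def)

lemma simple_graph_edge_at:
  assumes "simple_graph V E" "e \<in> E" "v \<in> e"
  obtains w where "e = {v, w}"
proof -
  have "card e = 2"
    using assms(1,2) by (simp add: simple_graph_def)
  then obtain a b where "e = {a, b}"
    by (auto simp: card_2_iff)
  then show thesis
    using assms(3) that by auto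
qed

lemma closed_nbhd_subset: "simple_graph V E \<Longrightarrow> v \<in> V \<Longrightarrow> closed_nbhd E v \<subseteq> V"
  by (auto simp: closed_nbhd_def dest: simple_graph_edgeD)

lemma finite_closed_nbhd: "simple_graph V E \<Longrightarrow> v \<in> V \<Longrightarrow> finite (closed_nbhd E v)"
  using closed_nbhd_subset finite_subset simple_graph_def by metis

lemma simple_graph_finite_edges: "simple_graph V E \<Longrightarrow> finite E"
  unfolding simple_graph_def by (meson PowI finite_Pow_iff finite_subset subsetI)

lemma card_closed_nbhd:
  assumes "simple_graph V E" "v \<in> V"
  shows "card (closed_nbhd E v) = Suc (degree E v)"
proof -
  let ?N = "{w. {v, w} \<in> E}"
  have "finite ?N"
    using finite_closed_nbhd[OF assms] by (simp add: closed_nbhd_def)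
  moreover have "v \<notin> ?N"
    using assms(1) by (auto simp: simple_graph_def)
  moreover have "card ?N = degree E v"
    unfolding degree_def
  proof (rule bij_betw_same_card[OF bij_betw_imageI])
    show "inj_on (\<lambda>w. {v, w}) ?N"
      by (auto simp: inj_on_def doubleton_eq_iff)
    have "\<exists>w. e = {v, w}" if "e \<in> E" "v \<in> e" for e
      using simple_graph_edge_at[OF assms(1) that] by blast
    then show "(\<lambda>w. {v, w}) ` ?N = {e \<in> E. v \<in> e}"
      by blast
  qed
  ultimately show ?thesis
    by (simp add: closed_nbhd_def)
qed

lemma sum_degree:
  assumes "simple_graph V E"
  shows "(\<Sum>v\<in>V. degree E v) = 2 * card E"
proof -
  have "card {v \<in> V. v \<in> e} = 2" if "e \<in> E" for e
  proof -
    have "{v \<in> V. v \<in> e} = e"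
      using assms that by (auto simp: simple_graph_def)
    then show ?thesis
      using assms that by (simp add: simple_graph_def)
  qed
  then show ?thesis
    unfolding degree_def
    using assms simple_graph_finite_edges[OF assms]
    by (intro sum_multicount) (auto simp: simple_graph_def)
qed

lemma degree_mono: "E \<subseteq> E' \<Longrightarrow> finite E' \<Longrightarrow> degree E v \<le> degree E' v"
  unfolding degree_def by (rule card_mono) auto

section \<open>Paths and distances\<close>

lemma path_edges_singleton [simp]: "path_edges [u] = {}"
  by (simp add: path_edges_def)

lemma path_edges_Cons: "path_edges (u # v # p) = insert {u, v} (path_edges (v # p))"
proof -
  have "path_edges (u # v # p) = (\<lambda>i. {(u # v # p) ! i, (v # p) ! i}) ` {..<Suc (length p)}"
    by (auto simp: path_edges_def)
  also have "\<dots> = insert {u, v} ((\<lambda>i. {(v # p) ! i, p ! i}) ` {..<length p})"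
    by (simp only: lessThan_Suc_eq_insert_0 image_insert image_image nth_Cons_0 nth_Cons_Suc)
  also have "(\<lambda>i. {(v # p) ! i, p ! i}) ` {..<length p} = path_edges (v # p)"
    by (auto simp: path_edges_def)
  finally show ?thesis .
qed

lemma path_edges_snoc:
  assumes "p \<noteq> []"
  shows "path_edges (p @ [v]) = insert {last p, v} (path_edges p)"
  using assms
proof (induction p rule: list_nonempty_induct)
  case (single u)
  then show ?case by (simp add: path_edges_Cons)
next
  case (cons u p)
  then show ?case by (cases p) (auto simp: path_edges_Cons)
qed

lemma path_leaves_set:
  assumes "p \<noteq> []" "hd p \<in> S" "last p \<notin> S"
  shows "\<exists>a b. {a, b} \<in> path_edges p \<and> a \<in> S \<and> b \<notin> S"
  using assms
proof (induction p rule: list_nonempty_induct)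
  case (single u)
  then show ?case by simp
next
  case (cons u p)
  then obtain v q where p: "p = v # q" by (cases p) auto
  show ?case
    using cons by (cases "v \<in> S") (auto simp: p path_edges_Cons)
qed

text \<open>Applied to the vertex set of one component of the tree minus its centre, this gives the
  edge attaching that component to the centre.\<close>

lemma connected_graph_leaves_set:
  assumes "connected_graph V E" "u \<in> V" "v \<in> V" "u \<in> S" "v \<notin> S"
  obtains a b where "{a, b} \<in> E" "a \<in> S" "b \<notin> S"
proof -
  obtain p where "p \<in> paths_between V E u v"
    using assms(1-3) unfolding connected_graph_def by blast
  then show thesis
    using path_leaves_set[of p S] assms(4,5) that
    unfolding paths_between_def gpath_def by blast
qed

lemma gdist_le_iff:
  "gdist V E u v \<le> enat n \<longleftrightarrow> (\<exists>p\<in>paths_between V E u v. length p \<le> Suc n)"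
proof
  assume le: "gdist V E u v \<le> enat n"
  let ?A = "(\<lambda>p. enat (length p - 1)) ` paths_between V E u v"
  \<comment> \<open>Over no paths the infimum would be infinity; over a nonempty subset of
    \<open>enat\<close> it is attained, which yields a shortest path.\<close>
  have "?A \<noteq> {}"
    using le by (auto simp: gdist_def Inf_enat_def)
  then have "Inf ?A \<in> ?A"
    unfolding Inf_enat_def by (auto intro: LeastI)
  then obtain p where "p \<in> paths_between V E u v" "gdist V E u v = enat (length p - 1)"
    unfolding gdist_def by blast
  then show "\<exists>p\<in>paths_between V E u v. length p \<le> Suc n"
    using le by (auto intro!: bexI[of _ p])
next
  assume "\<exists>p\<in>paths_between V E u v. length p \<le> Suc n"
  then show "gdist V E u v \<le> enat n"
    unfolding gdist_def by (auto intro!: INF_lower2)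
qed

lemma gdist_le_0_iff: "u \<in> V \<Longrightarrow> gdist V E u v \<le> 0 \<longleftrightarrow> u = v"
proof -
  assume u: "u \<in> V"
  have "u = v" if "p \<in> paths_between V E u v" "length p \<le> 1" for p
    using that by (cases p) (auto simp: paths_between_def gpath_def)
  moreover have "[u] \<in> paths_between V E u u"
    using u by (simp add: paths_between_def gpath_def)
  ultimately show ?thesis
    unfolding zero_enat_def gdist_le_iff by (auto intro: bexI[of _ "[u]"])
qed

lemma gdist_le_1_iff:
  assumes "simple_graph V E" "u \<in> V"
  shows "gdist V E u v \<le> 1 \<longleftrightarrow> v \<in> closed_nbhd E u"
proof -
  have "v \<in> closed_nbhd E u" if "p \<in> paths_between V E u v" "length p \<le> 2" for p
    using that
    by (cases p; cases "tl p")
      (auto simp: paths_between_def gpath_def closed_nbhd_def path_edges_Cons)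
  moreover have "[u, v] \<in> paths_between V E u v" if "{u, v} \<in> E"
    using that simple_graph_edgeD[OF assms(1) that]
    by (auto simp: paths_between_def gpath_def path_edges_Cons)
  moreover have "[u] \<in> paths_between V E u u"
    using assms(2) by (simp add: paths_between_def gpath_def)
  ultimately show ?thesis
    unfolding one_enat_def gdist_le_iff closed_nbhd_def
    by (force simp: numeral_2_eq_2)
qed

lemma gdist_le_2I:
  assumes "simple_graph V E" "u \<in> V" "closed_nbhd E u \<inter> closed_nbhd E v \<noteq> {}"
  shows "gdist V E u v \<le> enat 2"
proof (cases "v \<in> closed_nbhd E u")
  case True
  then have "gdist V E u v \<le> enat 1"
    using gdist_le_1_iff[OF assms(1,2)] by (simp add: one_enat_def)
  then show ?thesis
    by (rule order_trans) simp
next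
  case False
  obtain w where w: "w \<in> closed_nbhd E u" "w \<in> closed_nbhd E v"
    using assms(3) by blast
  \<comment> \<open>If \<open>w\<close> were \<open>u\<close> or \<open>v\<close>, then
    \<open>v\<close> would lie in the ball around \<open>u\<close>; so both memberships are genuine
    edges.\<close>
  then have e: "{u, w} \<in> E" "{w, v} \<in> E"
    using False by (auto simp: closed_nbhd_def insert_commute)
  have "[u, w, v] \<in> paths_between V E u v"
    using e False simple_graph_edgeD[OF assms(1) e(1)] simple_graph_edgeD[OF assms(1) e(2)]
    by (auto simp: paths_between_def gpath_def path_edges_Cons)
  then show ?thesis
    unfolding gdist_le_iff by force
qed

section \<open>Distance-balanced graphs\<close>

text \<open>Vertices of the difference are at distance at most 1 from \<open>x\<close> and more than
  1 from \<open>y\<close>. The end \<open>x\<close> is inserted separately, since it is adjacent to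
  \<open>y\<close> and so drops out of the difference.\<close>

lemma closer_superset:
  assumes "simple_graph V E" "{x, y} \<in> E"
  shows "insert x (closed_nbhd E x - closed_nbhd E y) \<subseteq> closer V E x y"
proof -
  note xy = simple_graph_edgeD[OF assms]
  have "gdist V E x x < gdist V E x y"
    using gdist_le_0_iff[OF xy(1)] xy(3) by (metis order.strict_trans1 not_le)
  moreover have "gdist V E u x < gdist V E u y"
    if u: "u \<in> closed_nbhd E x" "u \<notin> closed_nbhd E y" for u
  proof -
    have "u \<in> V"
      using closed_nbhd_subset[OF assms(1) xy(1)] u(1) by blast
    then show ?thesis
      using gdist_le_1_iff[OF assms(1)] u closed_nbhd_sym
      by (metis order.strict_trans1 not_le)
  qed
  ultimately show ?thesis
    using closed_nbhd_subset[OF assms(1) xy(1)] xy by (auto simp: closer_def)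
qed

text \<open>A vertex within 2 of \<open>y\<close> and strictly nearer to \<open>x\<close> is within
  1 of \<open>x\<close>, so nothing beyond the set of \<open>closer_superset\<close> can
  occur.\<close>

lemma closer_eq:
  assumes "simple_graph V E" "{x, y} \<in> E"
    and "\<And>u. u \<in> V \<Longrightarrow> closed_nbhd E y \<inter> closed_nbhd E u \<noteq> {}"
  shows "closer V E x y = insert x (closed_nbhd E x - closed_nbhd E y)"
proof
  show "closer V E x y \<subseteq> insert x (closed_nbhd E x - closed_nbhd E y)"
  proof
    fix u assume "u \<in> closer V E x y"
    then have u: "u \<in> V" "gdist V E u x < gdist V E u y"
      by (auto simp: closer_def)
    have "gdist V E u y \<le> enat 2"
      using gdist_le_2I assms(1,3) u(1) by (metis Int_commute)
    with u(2) have le: "gdist V E u x \<le> 1"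
      by (cases "gdist V E u x"; cases "gdist V E u y") (auto simp: one_enat_def)
    show "u \<in> insert x (closed_nbhd E x - closed_nbhd E y)"
    proof (cases "u = x")
      case False
      then have "\<not> gdist V E u x \<le> 0"
        using gdist_le_0_iff[OF u(1)] by blast
      then have "\<not> gdist V E u y \<le> 1"
        using u(2)
        by (cases "gdist V E u x"; cases "gdist V E u y") (auto simp: one_enat_def zero_enat_def)
      then show ?thesis
        using le gdist_le_1_iff[OF assms(1) u(1)] closed_nbhd_sym by (metis DiffI insertI2)
    qed simp
  qed
qed (rule closer_superset[OF assms(1,2)])

text \<open>The intersection is symmetric in \<open>x\<close> and \<open>y\<close>, so it cancels
  when the two ends of an edge are compared and only the degrees remain. The sum exceeds the size of
  the ball by one because \<open>x\<close> is counted in both summands.\<close>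

lemma card_insert_closed_nbhd_diff:
  assumes "simple_graph V E" "{x, y} \<in> E"
  shows "card (insert x (closed_nbhd E x - closed_nbhd E y))
      + card (closed_nbhd E x \<inter> closed_nbhd E y) = Suc (Suc (degree E x))"
proof -
  note xy = simple_graph_edgeD[OF assms]
  note fin = finite_closed_nbhd[OF assms(1) xy(1)]
  have "x \<in> closed_nbhd E y"
    using assms(2) by (simp add: closed_nbhd_def insert_commute)
  then have "card (insert x (closed_nbhd E x - closed_nbhd E y))
      = Suc (card (closed_nbhd E x - closed_nbhd E y))"
    using fin by simp
  then show ?thesis
    using card_Diff_subset_Int[of "closed_nbhd E x" "closed_nbhd E y"] fin
      card_mono[OF fin, of "closed_nbhd E x \<inter> closed_nbhd E y"] card_closed_nbhd[OF assms(1) xy(1)]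
    by auto
qed

text \<open>As all vertices are within 2 of \<open>x\<close>, the set \<open>closer V E y x\<close>
  is known exactly, while \<open>closer V E x y\<close> is only bounded from below. Balance
  therefore gives an inequality in one direction.\<close>

lemma distance_balanced_degree_le:
  assumes "simple_graph V E" "distance_balanced V E" "{x, y} \<in> E"
    and "\<And>u. u \<in> V \<Longrightarrow> closed_nbhd E x \<inter> closed_nbhd E u \<noteq> {}"
  shows "degree E x \<le> degree E y"
proof -
  have yx: "{y, x} \<in> E"
    using assms(3) by (simp add: insert_commute)
  have "finite (closer V E x y)"
    using assms(1) by (simp add: closer_def simple_graph_def)
  then have "card (insert x (closed_nbhd E x - closed_nbhd E y)) \<le> card (closer V E x y)"
    by (rule card_mono) (rule closer_superset[OF assms(1,3)])
  also have "\<dots> = card (closer V E y x)"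
    using assms(2,3) unfolding distance_balanced_def by blast
  also have "\<dots> = card (insert y (closed_nbhd E y - closed_nbhd E x))"
    using closer_eq[OF assms(1) yx assms(4)] by simp
  finally show ?thesis
    using card_insert_closed_nbhd_diff[OF assms(1,3)] card_insert_closed_nbhd_diff[OF assms(1) yx]
    by (simp add: Int_commute)
qed

text \<open>Here both sides of each edge are known exactly; after the common part cancels,
  regularity makes them equal in size.\<close>

lemma regular_diameter_two_distance_balanced:
  assumes "simple_graph V E"
    and "\<And>v. v \<in> V \<Longrightarrow> degree E v = d"
    and "\<And>u v. u \<in> V \<Longrightarrow> v \<in> V \<Longrightarrow> closed_nbhd E u \<inter> closed_nbhd E v \<noteq> {}"
  shows "distance_balanced V E"
  unfolding distance_balanced_def
proof (intro allI impI)
  fix x y assume xy: "{x, y} \<in> E"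
  then have yx: "{y, x} \<in> E"
    by (simp add: insert_commute)
  note xyV = simple_graph_edgeD[OF assms(1) xy]
  show "card (closer V E x y) = card (closer V E y x)"
    using card_insert_closed_nbhd_diff[OF assms(1) xy] card_insert_closed_nbhd_diff[OF assms(1) yx]
      closer_eq[OF assms(1) xy assms(3)] closer_eq[OF assms(1) yx assms(3)] xyV assms(2)
    by (simp add: Int_commute)
qed

text \<open>If \<open>q\<close> were the only neighbour of \<open>r\<close>, every path to
  \<open>r\<close> from elsewhere would pass through \<open>q\<close>. Then only \<open>r\<close> is
  nearer to \<open>r\<close> than to \<open>q\<close>, whereas both \<open>p\<close> and
  \<open>q\<close> are nearer to \<open>q\<close>.\<close>

lemma distance_balanced_no_leaf:
  assumes "simple_graph V E" "distance_balanced V E"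
    and "{p, q} \<in> E" "{q, r} \<in> E" "p \<noteq> r"
  obtains w where "{r, w} \<in> E" "w \<noteq> q"
proof -
  have "False" if leaf: "\<And>w. {r, w} \<in> E \<Longrightarrow> w = q"
  proof -
    note V = simple_graph_edgeD[OF assms(1,3)] simple_graph_edgeD[OF assms(1,4)]
    have "u = r" if "u \<in> closer V E r q" for u
    proof (rule ccontr)
      assume "u \<noteq> r"
      from that have lt: "gdist V E u r < gdist V E u q"
        by (simp add: closer_def)
      then obtain n where n: "gdist V E u r = enat n"
        by (cases "gdist V E u r") auto
      then obtain p where p: "p \<in> paths_between V E u r" "length p \<le> Suc n"
        using gdist_le_iff by (metis order_refl)
      then have p': "gpath V E p" "p = butlast p @ [r]" "hd p = u"
        unfolding paths_between_def gpath_def by (auto simp: append_butlast_last_id)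
      define p1 where "p1 = butlast p"
      have p1: "p = p1 @ [r]" "p1 \<noteq> []"
        using p' \<open>u \<noteq> r\<close> by (auto simp: p1_def)
      have "{last p1, r} \<in> E" "path_edges p1 \<subseteq> E"
        using p'(1) p1 by (auto simp: gpath_def path_edges_snoc)
      \<comment> \<open>The last vertex before \<open>r\<close> must be \<open>q\<close>, so
        deleting \<open>r\<close> from a shortest path leaves a path to \<open>q\<close> that is no
        longer.\<close>
      then have "p1 \<in> paths_between V E u q"
        using p'(1,3) p1 leaf[of "last p1"]
        by (auto simp: paths_between_def gpath_def insert_commute)
      moreover have "length p1 \<le> Suc n"
        using p(2) p1(1) by simp
      ultimately have "gdist V E u q \<le> enat n"
        unfolding gdist_le_iff by blast
      with lt n show False
        by simp
    qed
    then have "closer V E r q \<subseteq> {r}"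
      by blast
    from card_mono[OF _ this] have "card (closer V E r q) \<le> 1"
      by simp
    moreover have "{p, q} \<subseteq> closer V E q r"
    proof -
      have "p \<in> closed_nbhd E q" "p \<notin> closed_nbhd E r"
        using assms(3,5) leaf[of p] V by (auto simp: closed_nbhd_def insert_commute)
      then show ?thesis
        using closer_superset[OF assms(1,4)] by blast
    qed
    then have "2 \<le> card (closer V E q r)"
      using card_mono[of "closer V E q r" "{p, q}"] V assms(1)
      by (simp add: closer_def simple_graph_def)
    ultimately show False
      using assms(2,4) unfolding distance_balanced_def by fastforce
  qed
  then show thesis
    using that by blast
qed

section \<open>The starlike tree\<close>

text \<open>Connectivity attaches every branch to the centre. The branch \<open>a\<close>,
  \<open>b\<close>, \<open>d\<close> cannot be attached at \<open>b\<close>, which would become a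
  second vertex of degree above two, nor at both ends, which would close a cycle; so exactly one end
  is attached.\<close>

lemma starlike_tree_structure:
  assumes "is_S V E (3 # replicate k 1)"
  obtains c p q r xs where "distinct (c # p # q # r # xs)" "V = set (c # p # q # r # xs)"
    "length xs = k" "E = {{c, p}, {p, q}, {q, r}} \<union> (\<lambda>x. {c, x}) ` set xs"
proof -
  from assms obtain c ps where c: "c \<in> V" "degree E c > 2"
    and ps: "disjoint_union_of_paths (V - {c}) {e \<in> E. c \<notin> e} ps"
      "map length ps = 3 # replicate k 1"
    unfolding is_S_def by (elim conjE bexE exE)
  from assms have simple: "simple_graph V E" and conn: "connected_graph V E"
    and acyc: "acyclic_graph V E" and unique: "\<And>v. v \<in> V \<Longrightarrow> degree E v > 2 \<Longrightarrow> v = c"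
    using c unfolding is_S_def starlike_tree_def tree_def by blast+
  obtain l ls where ls: "ps = l # ls" "length l = 3" "map length ls = replicate k 1"
    using ps(2) by (auto simp: Cons_eq_map_conv)
  obtain a b d where l: "l = [a, b, d]"
    using ls(2) by (auto simp: numeral_3_eq_3 length_Suc_conv)
  have "\<forall>l\<in>set ls. length l = 1"
    using ls(3) by (metis (no_types, lifting) in_set_replicate list.set_map image_eqI)
  then have "map (\<lambda>l. [hd l]) ls = ls"
    by (intro map_idI) (auto simp: length_Suc_conv)
  then have "ls = map (\<lambda>x. [x]) (map hd ls)"
    by (simp add: comp_def)
  then obtain xs where xs: "ls = map (\<lambda>x. [x]) xs" ..
  have k: "length xs = k"
    using ls(3) by (metis xs length_map length_replicate)
  have "concat ps = a # b # d # xs"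
    by (simp add: ls(1) l xs)
  then have dist: "distinct (a # b # d # xs)" and V: "set (a # b # d # xs) = V - {c}"
    using ps(1) by (auto simp: disjoint_union_of_paths_def)
  have Ec: "{e \<in> E. c \<notin> e} = {{a, b}, {b, d}}"
    using ps(1) by (auto simp: disjoint_union_of_paths_def ls(1) l xs path_edges_Cons)
  have ab: "{a, b} \<in> E" and bd: "{b, d} \<in> E"
    using equalityD2[OF Ec] by simp_all
  have Ec_cases: "e = {a, b} \<or> e = {b, d}" if "e \<in> E" "c \<notin> e" for e
    using that equalityD1[OF Ec] by blast
  have Veq: "V = set (c # a # b # d # xs)" and cdist: "c \<notin> set (a # b # d # xs)"
    using V c(1) by auto
  have cx: "{c, x} \<in> E" if x: "x \<in> set xs" for x
  proof -
    \<comment> \<open>An edge leaving \<open>{x}\<close> is not one of the two edges inside the long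
      branch, so it contains \<open>c\<close>.\<close>
    obtain u v where uv: "{u, v} \<in> E" "u \<in> {x}" "v \<notin> {x}"
      by (rule connected_graph_leaves_set[OF conn, of x c "{x}"]) (use x Veq cdist in auto)
    then have "u \<notin> {a, b, d}"
      using x dist by auto
    then have "{u, v} \<noteq> {a, b}" "{u, v} \<noteq> {b, d}"
      by auto
    then have "c \<in> {u, v}"
      using Ec_cases uv(1) by blast
    then show ?thesis
      using uv x cdist by (auto simp: insert_commute)
  qed
  have cb: "{c, b} \<notin> E"
  proof
    assume "{c, b} \<in> E"
    then have "{{c, b}, {a, b}, {b, d}} \<subseteq> {e \<in> E. b \<in> e}"
      using ab bd by simp
    then have "card {{c, b}, {a, b}, {b, d}} \<le> degree E b"
      unfolding degree_def by (intro card_mono) (simp add: simple_graph_finite_edges[OF simple])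
    moreover have "{c, b} \<noteq> {a, b}" "{c, b} \<noteq> {b, d}" "{a, b} \<noteq> {b, d}"
      using dist cdist by (auto simp: doubleton_eq_iff)
    then have "card {{c, b}, {a, b}, {b, d}} = 3"
      by simp
    moreover have "b \<in> V" "b \<noteq> c"
      using Veq cdist by auto
    ultimately show False
      using unique[of b] by linarith
  qed
  have not_both: "\<not> ({c, a} \<in> E \<and> {c, d} \<in> E)"
  proof
    assume "{c, a} \<in> E \<and> {c, d} \<in> E"
    then have "gpath V E [c, a, b, d]" "{last [c, a, b, d], hd [c, a, b, d]} \<in> E"
      using ab bd dist cdist Veq by (auto simp: gpath_def path_edges_Cons insert_commute)
    then show False
      using acyc by (auto simp: acyclic_graph_def dest!: spec[of _ "[c, a, b, d]"])
  qed
  have some: "{c, a} \<in> E \<or> {c, d} \<in> E"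
  proof -
    obtain u v where uv: "{u, v} \<in> E" "u \<in> {a, b, d}" "v \<notin> {a, b, d}"
      by (rule connected_graph_leaves_set[OF conn, of a c "{a, b, d}"]) (use Veq cdist in auto)
    then have "{u, v} \<noteq> {a, b}" "{u, v} \<noteq> {b, d}"
      by auto
    then have "c \<in> {u, v}"
      using Ec_cases uv(1) by blast
    then show ?thesis
      using uv cb cdist by (auto simp: insert_commute)
  qed
  \<comment> \<open>Here \<open>p\<close> stands for whichever end of the long branch is attached,
    so that both cases below share this argument.\<close>
  have structure_E: "E = {{c, p}, {a, b}, {b, d}} \<union> (\<lambda>x. {c, x}) ` set xs"
    if p: "{c, p} \<in> E" "\<And>v. v \<in> {a, b, d} \<Longrightarrow> {c, v} \<in> E \<Longrightarrow> v = p" for p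
  proof
    show "E \<subseteq> {{c, p}, {a, b}, {b, d}} \<union> (\<lambda>x. {c, x}) ` set xs"
    proof
      fix e assume e: "e \<in> E"
      show "e \<in> {{c, p}, {a, b}, {b, d}} \<union> (\<lambda>x. {c, x}) ` set xs"
      proof (cases "c \<in> e")
        case True
        then obtain v where v: "e = {c, v}"
          using e simple_graph_edge_at[OF simple] by blast
        then have "v \<in> V" "v \<noteq> c"
          using simple_graph_edgeD[OF simple, of c v] e by auto
        then show ?thesis
          using v e p(2) Veq by auto
      next
        case False
        then show ?thesis
          using Ec_cases[OF e] by auto
      qed
    qed
    show "{{c, p}, {a, b}, {b, d}} \<union> (\<lambda>x. {c, x}) ` set xs \<subseteq> E"
      using p(1) cx ab bd by auto
  qed
  show thesis
  proof (cases "{c, a} \<in> E")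
    case True
    have "E = {{c, a}, {a, b}, {b, d}} \<union> (\<lambda>x. {c, x}) ` set xs"
      by (rule structure_E) (use True cb not_both in blast)+
    then show thesis
      by (rule that[rotated -1]) (use dist cdist Veq k in auto)
  next
    case False
    then have "E = {{c, d}, {a, b}, {b, d}} \<union> (\<lambda>x. {c, x}) ` set xs"
      by (intro structure_E) (use some cb in blast)+
    \<comment> \<open>The branch is attached at \<open>d\<close>, so it is read backwards.\<close>
    then have "E = {{c, d}, {d, b}, {b, a}} \<union> (\<lambda>x. {c, x}) ` set xs"
      by (simp add: insert_commute)
    then show thesis
      by (rule that[rotated -1]) (use dist cdist Veq k in auto)
  qed
qed

text \<open>The degree bound travels from \<open>c\<close> to its neighbours, and through a common
  neighbour \<open>a\<close> to a vertex \<open>v\<close> not adjacent to \<open>c\<close>.\<close>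

lemma balanced_supergraph_min_degree:
  assumes simple: "simple_graph V H" and balanced: "distance_balanced V H"
    and V: "V = insert c (insert p (insert q (insert r X)))" "p \<noteq> r"
    and edges: "{c, p} \<in> H" "{p, q} \<in> H" "{q, r} \<in> H" "\<And>x. x \<in> X \<Longrightarrow> {c, x} \<in> H"
    and "v \<in> V"
  shows "degree H c \<le> degree H v"
proof -
  let ?N = "closed_nbhd H"
  have near: "u \<in> ?N c" if "u \<in> V" "u \<noteq> q" "u \<noteq> r" for u
    using that V edges by (auto simp: closed_nbhd_def)
  have "?N c \<inter> ?N r \<noteq> {}"
  proof
    assume disj: "?N c \<inter> ?N r = {}"
    obtain w where w: "{r, w} \<in> H" "w \<noteq> q"
      using distance_balanced_no_leaf[OF simple balanced edges(2,3) V(2)] .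
    \<comment> \<open>Only \<open>q\<close> and \<open>r\<close> can lie outside the ball around
      \<open>c\<close>, and \<open>w\<close> is neither.\<close>
    then have "w \<in> ?N c"
      using near simple_graph_edgeD[OF simple w(1)] by blast
    then show False
      using w(1) disj by (auto simp: closed_nbhd_def)
  qed
  moreover have "p \<in> ?N c \<inter> ?N q"
    using edges by (auto simp: closed_nbhd_def insert_commute)
  ultimately have ecc: "?N c \<inter> ?N u \<noteq> {}" if "u \<in> V" for u
    using near[OF that] by (cases "u = q"; cases "u = r") auto
  have c_le: "degree H c \<le> degree H a" if "a \<in> ?N c" for a
  proof (cases "a = c")
    case False
    then have "{c, a} \<in> H"
      using that by (simp add: closed_nbhd_def)
    then show ?thesis
      using ecc by (rule distance_balanced_degree_le[OF simple balanced])
  qed simp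
  show ?thesis
  proof (cases "v \<in> ?N c")
    case False
    then have v: "v \<in> {q, r}"
      using near \<open>v \<in> V\<close> by blast
    obtain a where a: "a \<in> ?N c" "a \<in> ?N v"
      using ecc[OF \<open>v \<in> V\<close>] by blast
    then have "{a, v} \<in> H"
      using False by (auto simp: closed_nbhd_def insert_commute)
    \<comment> \<open>From \<open>a\<close>, the vertices \<open>q\<close> and \<open>r\<close> are
      reached through \<open>v\<close>, which is one of these two adjacent vertices; all others are
      reached through \<open>c\<close>.\<close>
    moreover have "?N a \<inter> ?N u \<noteq> {}" if "u \<in> V" for u
    proof (cases "u \<in> {q, r}")
      case True
      then have "v \<in> ?N u"
        using v edges(3) by (auto simp: closed_nbhd_def insert_commute)
      moreover have "v \<in> ?N a"
        using a(2) closed_nbhd_sym[of v H a] by simp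
      ultimately show ?thesis
        by blast
    next
      case False
      then have "c \<in> ?N u" "c \<in> ?N a"
        using near[OF that] a(1) closed_nbhd_sym[of c H u] closed_nbhd_sym[of c H a] by simp_all
      then show ?thesis
        by blast
    qed
    ultimately have "degree H a \<le> degree H v"
      using distance_balanced_degree_le[OF simple balanced] by blast
    then show ?thesis
      using c_le[OF a(1)] by linarith
  qed (rule c_le)
qed

section \<open>The complement of a cycle\<close>

text \<open>For a distinct list of at least three entries this is the complement of the cycle
  visiting them in order and returning to the first. Working with indices turns adjacency into
  arithmetic modulo the length.\<close>

definition co_cycle :: "'a list \<Rightarrow> 'a set set" where
  "co_cycle l = {{l ! i, l ! j} | i j. i < length l \<and> j < length l \<and> i \<noteq> j \<and>
     j \<noteq> Suc i mod length l \<and> i \<noteq> Suc j mod length l}"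

lemma simple_graph_co_cycle: "distinct l \<Longrightarrow> simple_graph (set l) (co_cycle l)"
  by (auto simp: simple_graph_def co_cycle_def nth_eq_iff_index_eq)

text \<open>In a distinct list an unordered pair of entries determines its indices up to a swap, and
  the condition on the indices is symmetric.\<close>

lemma co_cycle_edge_iff:
  assumes "distinct l" "i < length l" "j < length l"
  shows "{l ! i, l ! j} \<in> co_cycle l
    \<longleftrightarrow> i \<noteq> j \<and> j \<noteq> Suc i mod length l \<and> i \<noteq> Suc j mod length l"
    (is "?e \<in> _ \<longleftrightarrow> ?P i j")
proof
  assume "?e \<in> co_cycle l"
  then obtain a b where ab: "?e = {l ! a, l ! b}" "a < length l" "b < length l" "?P a b"
    unfolding co_cycle_def mem_Collect_eq by (elim exE conjE) (intro that conjI)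
  then have "(a = i \<and> b = j) \<or> (a = j \<and> b = i)"
    using assms by (simp add: doubleton_eq_iff nth_eq_iff_index_eq) metis
  then show "?P i j"
    using ab(4) by metis
next
  assume "?P i j"
  then show "?e \<in> co_cycle l"
    using assms unfolding co_cycle_def by (intro CollectI exI[of _ i] exI[of _ j]) simp
qed

lemma card_closed_nbhd_co_cycle:
  assumes "distinct l" "length l \<ge> 3" "v \<in> set l"
  shows "card (closed_nbhd (co_cycle l) v) = length l - 2"
proof -
  define n where "n = length l"
  obtain i where i: "i < n" "v = l ! i"
    using assms(3) by (auto simp: in_set_conv_nth n_def)
  \<comment> \<open>The cyclic successor \<open>s\<close> and predecessor \<open>t\<close> of
    \<open>i\<close>, with the wrap-around written out. They are the only indices missing from the
    ball, and they differ because \<open>n\<close> is at least 3.\<close>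
  define s where "s = (if Suc i = n then 0 else Suc i)"
  define t where "t = (if i = 0 then n - 1 else i - 1)"
  have n: "n \<ge> 3"
    using assms(2) by (simp add: n_def)
  have st: "s < n" "t < n" "s \<noteq> t" "s \<noteq> i" "t \<noteq> i"
    using i n by (auto simp: s_def t_def)
  have s: "Suc i mod n = s"
    using i by (auto simp: s_def)
  have t: "i = Suc j mod n \<longleftrightarrow> j = t" if "j < n" for j
    using i n that by (cases "Suc j = n") (auto simp: t_def)
  have nbhd: "l ! j \<in> closed_nbhd (co_cycle l) v \<longleftrightarrow> j \<noteq> s \<and> j \<noteq> t" if "j < n" for j
    using co_cycle_edge_iff[OF assms(1), of i j] i that st(4,5) s t[OF that] assms(1)
    by (auto simp: closed_nbhd_def n_def nth_eq_iff_index_eq)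
  have "closed_nbhd (co_cycle l) v = (!) l ` ({..<n} - {s, t})"
  proof (intro equalityI subsetI)
    fix w assume w: "w \<in> closed_nbhd (co_cycle l) v"
    then obtain j where "j < n" "w = l ! j"
      using closed_nbhd_subset[OF simple_graph_co_cycle[OF assms(1)] assms(3)]
      by (metis in_set_conv_nth n_def subsetD)
    then show "w \<in> (!) l ` ({..<n} - {s, t})"
      using w nbhd by auto
  qed (use nbhd in auto)
  moreover have "inj_on ((!) l) ({..<n} - {s, t})"
    using assms(1) by (auto simp: inj_on_def nth_eq_iff_index_eq n_def)
  moreover have "card ({..<n} - {s, t}) = n - 2"
    using st by (simp add: card_Diff_subset)
  ultimately show ?thesis
    by (simp add: card_image n_def)
qed

lemma degree_co_cycle:
  assumes "distinct l" "length l \<ge> 3" "v \<in> set l"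
  shows "degree (co_cycle l) v = length l - 3"
  using card_closed_nbhd[OF simple_graph_co_cycle[OF assms(1)] assms(3)]
    card_closed_nbhd_co_cycle[OF assms] by linarith

text \<open>Two balls of size n - 2 among n vertices must meet once 2(n - 2) > n, that is, for n at
  least 5.\<close>

lemma distance_balanced_co_cycle:
  assumes "distinct l" "length l \<ge> 5"
  shows "distance_balanced (set l) (co_cycle l)"
proof (rule regular_diameter_two_distance_balanced)
  show simple: "simple_graph (set l) (co_cycle l)"
    using assms(1) by (rule simple_graph_co_cycle)
  show "degree (co_cycle l) v = length l - 3" if "v \<in> set l" for v
    using degree_co_cycle assms that by fastforce
  fix u v assume uv: "u \<in> set l" "v \<in> set l"
  show "closed_nbhd (co_cycle l) u \<inter> closed_nbhd (co_cycle l) v \<noteq> {}" (is "?U \<inter> ?W \<noteq> {}")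
  proof
    assume "?U \<inter> ?W = {}"
    then have "card (?U \<union> ?W) = card ?U + card ?W"
      using finite_closed_nbhd[OF simple] uv by (simp add: card_Un_disjoint)
    moreover have "?U \<union> ?W \<subseteq> set l"
      using closed_nbhd_subset[OF simple] uv by blast
    then have "card (?U \<union> ?W) \<le> length l"
      using card_mono distinct_card[OF assms(1)] by (metis List.finite_set)
    moreover have "card ?U = length l - 2" "card ?W = length l - 2"
      using card_closed_nbhd_co_cycle assms uv by fastforce+
    ultimately show False
      using assms(2) by linarith
  qed
qed

text \<open>Cyclically consecutive entries of this list are never adjacent in the tree. A nonempty
  \<open>xs\<close> is what separates \<open>q\<close> from its neighbour \<open>p\<close>.\<close>

lemma starlike_tree_subset_co_cycle:
  assumes "distinct (c # p # q # r # xs)" "xs \<noteq> []"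
  shows "{{c, p}, {p, q}, {q, r}} \<union> (\<lambda>x. {c, x}) ` set xs \<subseteq> co_cycle (c # q # xs @ [p, r])"
proof -
  let ?l = "c # q # xs @ [p, r]" and ?k = "length xs"
  have k: "?k > 0" "length ?l = ?k + 4"
    using assms(2) by auto
  \<comment> \<open>The last index is \<open>?k + 3\<close>; the final condition excludes the pair
    of first and last entry, which are consecutive on the cycle.\<close>
  have mem: "{?l ! i, ?l ! j} \<in> co_cycle ?l"
    if "i + 2 \<le> j" "j < ?k + 4" "i > 0 \<or> j < ?k + 3" for i j
  proof -
    have "Suc i mod length ?l = Suc i" "Suc j mod length ?l \<noteq> i"
      unfolding k(2) using that by (auto simp: mod_Suc)
    moreover have "i < length ?l" "j < length ?l" "i \<noteq> j" "j \<noteq> Suc i"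
      unfolding k(2) using that by simp_all
    moreover have "distinct ?l"
      using assms(1) by auto
    ultimately show ?thesis
      using co_cycle_edge_iff by metis
  qed
  have nth: "?l ! 0 = c" "?l ! 1 = q" "?l ! (?k + 2) = p" "?l ! (?k + 3) = r"
    by (simp_all add: nth_append nth_Cons')
  have "{c, x} \<in> co_cycle ?l" if x: "x \<in> set xs" for x
  proof -
    obtain j where "j < ?k" "x = xs ! j"
      using x by (auto simp: in_set_conv_nth)
    then show ?thesis
      using mem[of 0 "j + 2"] by (simp add: nth_append)
  qed
  moreover have "{c, p} \<in> co_cycle ?l" "{q, p} \<in> co_cycle ?l" "{q, r} \<in> co_cycle ?l"
    using mem[of 0 "?k + 2"] mem[of 1 "?k + 2"] mem[of 1 "?k + 3"] k(1)
    unfolding nth by auto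
  ultimately show ?thesis
    by (auto simp: insert_commute)
qed

section \<open>The balancing number\<close>

theorem theorem4p6:
  fixes V :: "'a set" and E :: "'a set set" and m :: nat
  assumes "m \<ge> 3"
    and "is_S V E (3 # replicate (m - 1) 1)"
  shows "real (balancing_number V E) = ((real m)\<^sup>2 + real m - 4) / 2"
proof -
  obtain c p q r xs where dist: "distinct (c # p # q # r # xs)"
    and V: "V = set (c # p # q # r # xs)" and len: "length xs = m - 1"
    and E: "E = {{c, p}, {p, q}, {q, r}} \<union> (\<lambda>x. {c, x}) ` set xs"
    using starlike_tree_structure[OF assms(2)] .
  define l where "l = c # q # xs @ [p, r]"
  have l: "distinct l" "set l = V" "length l = m + 3"
    using dist V len assms(1) by (auto simp: l_def)
  have cardV: "card V = m + 3"
    using l distinct_card by metis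
  \<comment> \<open>The centre has \<open>m\<close> edges: one to \<open>p\<close> and
    \<open>m - 1\<close> to the leaves in \<open>xs\<close>.\<close>
  have star: "card ((\<lambda>x. {c, x}) ` insert p (set xs)) = m"
  proof -
    have "inj_on (\<lambda>x. {c, x}) (insert p (set xs))"
      by (auto simp: inj_on_def doubleton_eq_iff)
    then have "card ((\<lambda>x. {c, x}) ` insert p (set xs)) = card (insert p (set xs))"
      by (rule card_image)
    then show ?thesis
      using dist len assms(1) by (simp add: distinct_card)
  qed
  have cardE: "card E = m + 2"
  proof -
    have "E = insert {p, q} (insert {q, r} ((\<lambda>x. {c, x}) ` insert p (set xs)))"
      unfolding E by auto
    moreover have "{q, r} \<notin> (\<lambda>x. {c, x}) ` insert p (set xs)"
      "{p, q} \<notin> insert {q, r} ((\<lambda>x. {c, x}) ` insert p (set xs))"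
      using dist by (auto simp: doubleton_eq_iff)
    ultimately show ?thesis
      using star by (simp del: image_insert)
  qed
  have finE: "finite E"
    unfolding E by simp
  have degc: "m \<le> degree E c"
  proof -
    have "(\<lambda>x. {c, x}) ` insert p (set xs) \<subseteq> {e \<in> E. c \<in> e}"
      unfolding E by auto
    then have "card ((\<lambda>x. {c, x}) ` insert p (set xs)) \<le> degree E c"
      unfolding degree_def by (intro card_mono) (simp add: finE)
    then show ?thesis
      unfolding star .
  qed
  define F\<^sub>0 where "F\<^sub>0 = co_cycle l - E"
  have "E \<subseteq> co_cycle l"
    using starlike_tree_subset_co_cycle[OF dist] len assms(1) unfolding E l_def by force
  then have EF: "E \<union> F\<^sub>0 = co_cycle l" "E \<inter> F\<^sub>0 = {}"
    by (auto simp: F\<^sub>0_def)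
  have simple: "simple_graph V (co_cycle l)"
    using simple_graph_co_cycle l by metis
  have "2 * card (co_cycle l) = (m + 3) * m"
  proof -
    have "(\<Sum>v\<in>V. degree (co_cycle l) v) = (\<Sum>v\<in>V. m)"
      using degree_co_cycle[OF l(1)] l by (intro sum.cong) auto
    then show ?thesis
      using sum_degree[OF simple] cardV by simp
  qed
  moreover have "card (co_cycle l) = card E + card F\<^sub>0"
    using EF simple_graph_finite_edges[OF simple] by (metis card_Un_disjoint finite_Un)
  \<comment> \<open>The equation stays doubled, which avoids division of natural numbers.\<close>
  ultimately have cardF: "2 * (m + 2 + card F\<^sub>0) = (m + 3) * m"
    using cardE by simp
  have "balancing_number V E = card F\<^sub>0"
    unfolding balancing_number_def
  proof (rule Least_equality)
    have "distance_balanced V (co_cycle l)"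
      using distance_balanced_co_cycle[OF l(1)] l assms(1) by simp
    then show "\<exists>F. F \<inter> E = {} \<and> card F = card F\<^sub>0 \<and>
        simple_graph V (E \<union> F) \<and> distance_balanced V (E \<union> F)"
      using EF simple by (metis Int_commute)
  next
    fix k assume "\<exists>F. F \<inter> E = {} \<and> card F = k \<and>
        simple_graph V (E \<union> F) \<and> distance_balanced V (E \<union> F)"
    then obtain F where F: "F \<inter> E = {}" "card F = k"
      and simpleF: "simple_graph V (E \<union> F)" and balF: "distance_balanced V (E \<union> F)"
      by blast
    have "m \<le> degree (E \<union> F) v" if "v \<in> V" for v
    proof -
      have "degree E c \<le> degree (E \<union> F) c"
        using simple_graph_finite_edges[OF simpleF] by (intro degree_mono) auto
      also have "\<dots> \<le> degree (E \<union> F) v"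
        by (rule balanced_supergraph_min_degree[OF simpleF balF, of c p q r "set xs"])
          (use V E dist that in auto)
      finally show ?thesis
        using degc by simp
    qed
    \<comment> \<open>By the handshake identity, minimum degree \<open>m\<close> forces at least as
      many edges as the \<open>m\<close>-regular graph \<open>co_cycle l\<close> has, so
      \<open>F\<close> is at least as large as \<open>F\<^sub>0\<close>.\<close>
    then have "(\<Sum>v\<in>V. m) \<le> 2 * card (E \<union> F)"
      unfolding sum_degree[OF simpleF, symmetric] by (rule sum_mono)
    also have "card (E \<union> F) = m + 2 + k"
      using F cardE simple_graph_finite_edges[OF simpleF]
      by (simp add: card_Un_disjoint Int_commute)
    finally show "card F\<^sub>0 \<le> k"
      using cardV cardF by simp
  qed
  moreover have "real (2 * (m + 2 + card F\<^sub>0)) = real ((m + 3) * m)"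
    using cardF by simp
  ultimately show ?thesis
    by (simp add: field_simps power2_eq_square)
qed

end
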